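(* The set of real numbers $r$ such that $r$ is a root of $\mathrm{NRel}(G;p)$ for some finite simple graph $G$ is unbounded.
   Context: For a finite simple undirected graph $G$ with $n$ nodes, a connected set of $G$ is a nonempty subset of nodes inducing a connected subgraph. Let $c_k$ be the number of connected sets of $G$ of order $k$. The node reliability polynomial of $G$ is $\mathrm{NRel}(G;p)=\sum_{k=1}^n c_k p^k(1-p)^{n-k}$, regarded as a polynomial in $p$; its roots are the node reliability roots of $G$. *)

theory Defs
  imports "HOL-Analysis.Analysis" "HOL-Computational_Algebra.Polynomial"
    "Graph_Theory.Graph_Theory"
begin

text \<open>
  Finite simple undirected graphs are modelled by the locale \<^locale>\<open>pair_graph\<close>: a finite vertex
  set with a symmetric irreflexive set of ordered pairs.
\<close>

definition connected_sets :: "'a pair_pre_digraph \<Rightarrow> nat \<Rightarrow> 'a set set" where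
  "connected_sets G k =
     {S. S \<subseteq> pverts G \<and> S \<noteq> {} \<and> card S = k \<and>
         Digraph_Component.connected (with_proj G \<restriction> S)}"

text \<open>
  For the graph without vertices this is the zero polynomial, so statements about roots must
  exclude that graph; for any other finite graph it is nonzero, its linear coefficient being the
  number of vertices.
\<close>

definition NRel :: "'a pair_pre_digraph \<Rightarrow> real poly" where
  "NRel G = (let n = card (pverts G) in
     \<Sum>k = 1..n. smult (real (card (connected_sets G k))) ([:0, 1:] ^ k * [:1, -1:] ^ (n - k)))"

end

theory Submission
  imports Defs
begin

text \<open>
  Take \<open>G\<close> to be the complement of the path on \<open>n\<close> vertices. A set of vertices is disconnected
  in \<open>G\<close> iff the path contains a spanning complete bipartite graph on it, so the only disconnected
  sets are the \<open>n - 1\<close> pairs \<open>{i, i + 1}\<close> and the \<open>n - 2\<close> triples \<open>{i, i + 1, i + 2}\<close>. In terms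
  of \<open>w = 1 / (1 - p)\<close> the node reliability polynomial becomes, up to the factor \<open>w\<^sup>-\<^sup>n\<close>,
  \<open>w\<^sup>n - 1 - (w - 1)\<^sup>2 (1 + (n - 2) w)\<close>. This is \<open>- 2\<close> at \<open>w = 0\<close>, while at any fixed \<open>w < 0\<close>
  close to \<open>0\<close> it is positive for large \<open>n\<close>. Hence there are roots \<open>w < 0\<close> arbitrarily close
  to \<open>0\<close>, and \<open>p = 1 - 1 / w\<close> is then arbitrarily large.
\<close>

section \<open>Connectedness in terms of cuts\<close>

text \<open>A walk starting on one side of an arcless cut never leaves that side; conversely, the
  vertices reachable from \<open>u\<close> form one side of such a cut unless they exhaust
  \<open>S\<close>. For a complement graph, an arcless cut is a complete bipartite pattern in the
  original graph.\<close>

lemma connected_induce_iff_no_cut: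
  assumes sym: "symmetric (with_proj G)" and ne: "S \<noteq> {}"
  shows "Digraph_Component.connected (with_proj G \<restriction> S) \<longleftrightarrow>
    \<not> (\<exists>A B. A \<noteq> {} \<and> B \<noteq> {} \<and> A \<inter> B = {} \<and> A \<union> B = S \<and> (\<forall>a\<in>A. \<forall>b\<in>B. (a, b) \<notin> parcs G))"
proof -
  define R where "R = {(x, y). (x, y) \<in> parcs G \<and> x \<in> S \<and> y \<in> S}"
  have G_sym: "(y, x) \<in> parcs G" if "(x, y) \<in> parcs G" for x y
    using sym that by (auto simp: symmetric_def dest: symD)
  \<comment> \<open>\<open>connected\<close> refers to the symmetric closure, which adds no arcs
    here.\<close>
  have "(arcs_ends (with_proj G \<restriction> S))\<^sup>s = R"
    using G_sym by (auto simp: symcl_def arcs_ends_conv R_def image_iff)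
  then have conn: "Digraph_Component.connected (with_proj G \<restriction> S) \<longleftrightarrow>
      (\<forall>u\<in>S. \<forall>v\<in>S. (u, v) \<in> rtrancl_on S R)"
    using ne by (simp add: connected_conv)
  show ?thesis
    unfolding conn
  proof (intro iffI notI ballI)
    assume reach: "\<forall>u\<in>S. \<forall>v\<in>S. (u, v) \<in> rtrancl_on S R"
      and "\<exists>A B. A \<noteq> {} \<and> B \<noteq> {} \<and> A \<inter> B = {} \<and> A \<union> B = S \<and>
        (\<forall>a\<in>A. \<forall>b\<in>B. (a, b) \<notin> parcs G)"
    then obtain A B a b where AB: "A \<inter> B = {}" "A \<union> B = S" "a \<in> A" "b \<in> B"
      "\<forall>a\<in>A. \<forall>b\<in>B. (a, b) \<notin> parcs G"
      by blast
    then have "(a, b) \<in> rtrancl_on S R"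
      using reach by blast
    then have "b \<in> A"
    proof (induction rule: rtrancl_on_induct)
      case base
      show ?case by fact
    next
      case (step x y)
      then show ?case
        using AB unfolding R_def by blast
    qed
    then show False
      using AB by blast
  next
    fix u v
    assume no_cut: "\<not> (\<exists>A B. A \<noteq> {} \<and> B \<noteq> {} \<and> A \<inter> B = {} \<and> A \<union> B = S \<and>
        (\<forall>a\<in>A. \<forall>b\<in>B. (a, b) \<notin> parcs G))"
      and uv: "u \<in> S" "v \<in> S"
    define A where "A = {x \<in> S. (u, x) \<in> rtrancl_on S R}"
    have "A \<noteq> {}" "A \<inter> (S - A) = {}" "A \<union> (S - A) = S"
      using uv by (auto simp: A_def)
    moreover have "\<forall>a\<in>A. \<forall>b\<in>S - A. (a, b) \<notin> parcs G"
      by (auto simp: A_def R_def intro: rtrancl_on_into_rtrancl_on)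
    ultimately have "\<exists>A B. A \<noteq> {} \<and> B \<noteq> {} \<and> A \<inter> B = {} \<and> A \<union> B = S \<and>
        (\<forall>a\<in>A. \<forall>b\<in>B. (a, b) \<notin> parcs G)" if "S - A \<noteq> {}"
      using that by (intro exI[of _ A] exI[of _ "S - A"] conjI)
    with no_cut have "S - A = {}"
      by satx
    then show "(u, v) \<in> rtrancl_on S R"
      using uv by (auto simp: A_def)
  qed
qed

section \<open>Disconnected sets in the complement of a path\<close>

definition path_complement :: "nat \<Rightarrow> nat pair_pre_digraph" where
  "path_complement n = \<lparr> pverts = {..<n},
     parcs = {(i, j). i < n \<and> j < n \<and> i \<noteq> j \<and> j \<noteq> Suc i \<and> i \<noteq> Suc j} \<rparr>"

lemma pverts_path_complement [simp]: "pverts (path_complement n) = {..<n}"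
  by (simp add: path_complement_def)

lemma parcs_path_complement [simp]:
  "(i, j) \<in> parcs (path_complement n) \<longleftrightarrow> i < n \<and> j < n \<and> i \<noteq> j \<and> j \<noteq> Suc i \<and> i \<noteq> Suc j"
  by (simp add: path_complement_def)

lemma symmetric_path_complement: "symmetric (with_proj (path_complement n))"
  by (auto simp: symmetric_def intro: symI)

lemma pair_graph_path_complement: "pair_graph (path_complement n)"
proof
  have "parcs (path_complement n) \<subseteq> {..<n} \<times> {..<n}"
    by auto
  then show "finite (parcs (path_complement n))"
    by (rule finite_subset) simp
  show "symmetric (with_proj (path_complement n))"
    by (rule symmetric_path_complement)
qed auto

text \<open>The least element \<open>m\<close> has only the neighbour \<open>m + 1\<close> above it,
  so the side opposite to \<open>m\<close> is \<open>{m + 1}\<close>; this leaves only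
  \<open>m\<close> and \<open>m + 2\<close> for the side of \<open>m\<close>.\<close>

lemma complete_bipartite_in_path:
  fixes A B :: "nat set"
  assumes ne: "A \<noteq> {}" "B \<noteq> {}"
    and adj: "\<And>a b. a \<in> A \<Longrightarrow> b \<in> B \<Longrightarrow> b = Suc a \<or> a = Suc b"
  shows "\<exists>i. A \<union> B = {i, i + 1} \<or> A \<union> B = {i, i + 1, i + 2}"
proof -
  \<comment> \<open>Stated for arbitrary sides, since the least element may lie in either and the
    roles are then swapped.\<close>
  have star: "\<exists>i. A \<union> B = {i, i + 1} \<or> A \<union> B = {i, i + 1, i + 2}"
    if m: "m \<in> A" "\<And>x. x \<in> A \<union> B \<Longrightarrow> m \<le> x" and ne: "B \<noteq> {}"
      and adj: "\<And>a b. a \<in> A \<Longrightarrow> b \<in> B \<Longrightarrow> b = Suc a \<or> a = Suc b"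
    for A B :: "nat set" and m
  proof -
    have "b = Suc m" if "b \<in> B" for b
      using adj[OF m(1) that] m(2)[of b] that by auto
    then have B: "B = {Suc m}"
      using ne by blast
    have "a = m \<or> a = m + 2" if "a \<in> A" for a
      using adj[OF that, of "Suc m"] B by auto
    then have "A = {m} \<or> A = {m, m + 2}"
      using m(1) by blast
    then show ?thesis
      using B by auto
  qed
  define m where "m = (LEAST x. x \<in> A \<union> B)"
  have m: "m \<in> A \<union> B"
    using ne unfolding m_def by (metis LeastI Un_iff all_not_in_conv)
  have le: "m \<le> x" if "x \<in> A \<union> B" for x
    unfolding m_def using that by (rule Least_le)
  show ?thesis
  proof (cases "m \<in> A")
    case True
    then show ?thesis
      using star[of m A B] le ne adj by blast
  next
    case False
    then have "m \<in> B"
      using m by blast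
    then show ?thesis
      using star[of m B A] le ne adj by (metis Un_commute)
  qed
qed

lemma disconnected_path_complement_iff:
  assumes S: "S \<subseteq> {..<n}" "S \<noteq> {}"
  shows "\<not> Digraph_Component.connected (with_proj (path_complement n) \<restriction> S) \<longleftrightarrow>
    (\<exists>i. S = {i, i + 1} \<or> S = {i, i + 1, i + 2})"
  unfolding connected_induce_iff_no_cut[OF symmetric_path_complement S(2)] not_not
proof
  assume "\<exists>A B. A \<noteq> {} \<and> B \<noteq> {} \<and> A \<inter> B = {} \<and> A \<union> B = S \<and>
    (\<forall>a\<in>A. \<forall>b\<in>B. (a, b) \<notin> parcs (path_complement n))"
  then obtain A B where AB: "A \<noteq> {}" "B \<noteq> {}" "A \<inter> B = {}" "A \<union> B = S"
    "\<forall>a\<in>A. \<forall>b\<in>B. (a, b) \<notin> parcs (path_complement n)"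
    by blast
  have "b = Suc a \<or> a = Suc b" if "a \<in> A" "b \<in> B" for a b
  proof -
    have "a < n" "b < n" "a \<noteq> b"
      using that AB(3,4) S(1) by auto
    then show ?thesis
      using AB(5) that by auto
  qed
  from complete_bipartite_in_path[OF AB(1,2) this]
  show "\<exists>i. S = {i, i + 1} \<or> S = {i, i + 1, i + 2}"
    using AB(4) by simp
next
  assume "\<exists>i. S = {i, i + 1} \<or> S = {i, i + 1, i + 2}"
  then obtain i where "S = {i, i + 1} \<or> S = {i, i + 1, i + 2}"
    by blast
  then show "\<exists>A B. A \<noteq> {} \<and> B \<noteq> {} \<and> A \<inter> B = {} \<and> A \<union> B = S \<and>
    (\<forall>a\<in>A. \<forall>b\<in>B. (a, b) \<notin> parcs (path_complement n))"
  proof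
    \<comment> \<open>In both cases \<open>i + 1\<close> is adjacent in the path to all the rest of
      \<open>S\<close>, so in the complement it is isolated and forms one side of the cut.\<close>
    assume "S = {i, i + 1}"
    then show ?thesis
      by (intro exI[of _ "{i + 1}"] exI[of _ "{i}"]) simp
  next
    assume "S = {i, i + 1, i + 2}"
    then show ?thesis
      by (intro exI[of _ "{i + 1}"] exI[of _ "{i, i + 2}"]) (simp add: insert_commute)
  qed
qed

section \<open>Counting connected sets and the resulting polynomial\<close>

text \<open>The disconnected sets are removed from all \<open>k\<close>-subsets. For
  \<open>k = 0\<close> the formula fails, as the empty set is not a connected set. Truncated
  subtraction gives the right count for tiny \<open>n\<close> too.\<close>

lemma card_connected_sets_path_complement:
  assumes "k \<ge> 1"
  shows "real (card (connected_sets (path_complement n) k)) =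
    real (n choose k) - (if k = 2 then real (n - 1) else if k = 3 then real (n - 2) else 0)"
proof -
  define D where "D = {S. S \<subseteq> {..<n} \<and> card S = k \<and> (\<exists>i. S = {i, i + 1} \<or> S = {i, i + 1, i + 2})}"
  define U where "U = {S. S \<subseteq> {..<n} \<and> card S = k}"
  have "connected_sets (path_complement n) k = U - D"
  proof (intro set_eqI)
    fix S :: "nat set"
    have "S \<noteq> {}" if "card S = k"
      using that assms by auto
    then show "S \<in> connected_sets (path_complement n) k \<longleftrightarrow> S \<in> U - D"
      using disconnected_path_complement_iff[of S n]
      unfolding connected_sets_def U_def D_def pverts_path_complement by blast
  qed
  moreover have fin: "finite U" and sub: "D \<subseteq> U"
    by (auto simp: U_def D_def)
  moreover have "card U = n choose k"
    using n_subsets[of "{..<n}" k] by (simp add: U_def)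
  ultimately have 1: "real (card (connected_sets (path_complement n) k)) = real (n choose k) - real (card D)"
    using card_mono[OF fin sub] finite_subset[OF sub fin]
    by (simp add: card_Diff_subset of_nat_diff)
  \<comment> \<open>Each pair or triple determines \<open>i\<close> as its least element.\<close>
  have inj: "inj_on f X" if "\<And>i. i \<in> f i \<and> f i \<subseteq> {i..}" for f :: "nat \<Rightarrow> nat set" and X
    using that by (intro inj_onI antisym) (metis atLeast_iff subsetD)+
  have "card D = (if k = 2 then n - 1 else if k = 3 then n - 2 else 0)"
  proof -
    consider "k = 2" | "k = 3" | "k \<noteq> 2" "k \<noteq> 3"
      by blast
    then show ?thesis
    proof cases
      case 1
      then have "D = (\<lambda>i. {i, i + 1}) ` {..<n - 1}"
        by (auto simp: D_def)
      then show ?thesis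
        using 1 by (simp add: card_image[OF inj] del: add_Suc_right)
    next
      case 2
      then have "D = (\<lambda>i. {i, i + 1, i + 2}) ` {..<n - 2}"
        by (auto simp: D_def)
      then show ?thesis
        using 2 by (simp add: card_image[OF inj] del: add_Suc_right)
    next
      case 3
      then have "D = {}"
        by (auto simp: D_def)
      then show ?thesis
        using 3 by simp
    qed
  qed
  with 1 show ?thesis
    by simp
qed

lemma poly_NRel_path_complement:
  assumes n: "n \<ge> 3"
  shows "poly (NRel (path_complement n)) p = 1 - (1 - p) ^ n
    - real (n - 1) * p ^ 2 * (1 - p) ^ (n - 2) - real (n - 2) * p ^ 3 * (1 - p) ^ (n - 3)"
proof -
  define t where "t k = p ^ k * (1 - p) ^ (n - k)" for k
  have "poly (NRel (path_complement n)) p =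
      (\<Sum>k = 1..n. real (card (connected_sets (path_complement n) k)) * t k)"
    by (simp add: NRel_def poly_sum t_def)
  also have "\<dots> = (\<Sum>k = 1..n. real (n choose k) * t k -
      ((if k = 2 then real (n - 1) * t 2 else 0) + (if k = 3 then real (n - 2) * t 3 else 0)))"
    by (intro sum.cong) (auto simp: card_connected_sets_path_complement algebra_simps)
  \<comment> \<open>By \<open>n \<ge> 3\<close> both exceptional indices lie in the range of
    summation.\<close>
  also have "\<dots> = (\<Sum>k = 1..n. real (n choose k) * t k) - (real (n - 1) * t 2 + real (n - 2) * t 3)"
    using n by (simp add: sum_subtractf sum.distrib)
  also have "(\<Sum>k = 1..n. real (n choose k) * t k) = 1 - (1 - p) ^ n"
  proof -
    have "1 = (p + (1 - p)) ^ n"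
      by simp
    also have "\<dots> = (\<Sum>k\<le>n. real (n choose k) * t k)"
      unfolding binomial_ring t_def by (simp add: mult.assoc)
    also have "\<dots> = t 0 + (\<Sum>k = 1..n. real (n choose k) * t k)"
      by (simp add: atMost_atLeast0 sum.atLeast_Suc_atMost)
    finally show ?thesis
      by (simp add: t_def)
  qed
  finally show ?thesis
    by (simp add: t_def mult.assoc)
qed

section \<open>Large roots\<close>

text \<open>With \<open>p = (w - 1) / w\<close> and \<open>1 - p = 1 / w\<close>, multiplying by
  \<open>w ^ n\<close> turns the two correction terms into multiples of
  \<open>(w - 1)\<^sup>2\<close> and \<open>(w - 1) ^ 3\<close>, and
  \<open>(n - 1) + (n - 2) * (w - 1) = 1 + (n - 2) * w\<close>.\<close>

lemma NRel_path_complement_root_iff: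
  fixes w :: real
  assumes n: "n \<ge> 3" and w: "w \<noteq> 0"
  shows "poly (NRel (path_complement n)) (1 - 1 / w) = 0 \<longleftrightarrow>
    w ^ n - 1 - (w - 1)\<^sup>2 * (1 + real (n - 2) * w) = 0"
proof -
  obtain m where m: "n = m + 3"
    using n by (metis add.commute le_Suc_ex)
  have "w ^ n * poly (NRel (path_complement n)) (1 - 1 / w) =
      w ^ n - 1 - (w - 1)\<^sup>2 * (1 + real (n - 2) * w)"
    unfolding poly_NRel_path_complement[OF n] using w
    by (simp add: m field_simps power_add power2_eq_square power3_eq_cube)
  then show ?thesis
    using w by (metis mult_eq_0_iff power_not_zero)
qed

lemma path_complement_large_root:
  fixes M :: real
  shows "\<exists>n r. n \<ge> 3 \<and> r > M \<and> poly (NRel (path_complement n)) r = 0"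
proof -
  \<comment> \<open>A root \<open>w\<close> in \<open>[-e, 0)\<close> gives
    \<open>1 - 1 / w > 1 / e \<ge> M\<close>; the maximum keeps \<open>e\<close> positive and at
    most 1, so that powers of \<open>- e\<close> stay bounded by 1.\<close>
  define e where "e = 1 / max 1 M"
  have e: "0 < e" "e \<le> 1"
    by (auto simp: e_def)
  \<comment> \<open>This makes \<open>c * e - 1 \<ge> 2\<close> below, which outweighs
    \<open>(- e) ^ n - 1 \<ge> - 2\<close> whatever the parity of \<open>n\<close>.\<close>
  obtain N :: nat where N: "3 / e < real N"
    using reals_Archimedean2 by blast
  define n where "n = N + 3"
  define f where "f w = w ^ n - 1 - (w - 1)\<^sup>2 * (1 + real (n - 2) * w)" for w :: real
  have "f (- e) \<ge> 0"
  proof -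
    define c where "c = real (n - 2)"
    have "c * e \<ge> 3"
      using N e by (simp add: c_def n_def field_simps)
    moreover have "1 \<le> (- e - 1)\<^sup>2"
      using e by (simp add: power2_eq_square algebra_simps)
    ultimately have "1 * 2 \<le> (- e - 1)\<^sup>2 * (c * e - 1)"
      by (intro mult_mono) auto
    moreover have "\<bar>(- e) ^ n\<bar> \<le> 1"
      using e by (simp add: power_abs power_le_one)
    moreover have "f (- e) = (- e) ^ n - 1 + (- e - 1)\<^sup>2 * (c * e - 1)"
      by (simp add: f_def c_def right_diff_distrib)
    ultimately show ?thesis
      by linarith
  qed
  moreover have f0: "f 0 = - 2"
    by (simp add: f_def n_def)
  moreover have "continuous_on {- e..0} f"
    unfolding f_def by (intro continuous_intros)
  ultimately obtain w where w: "- e \<le> w" "w \<le> 0" "f w = 0"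
    using IVT2'[of f 0 0 "- e"] e by auto
  \<comment> \<open>The intermediate value may a priori be the endpoint 0, where
    \<open>1 / w\<close> is meaningless; \<open>f 0 = - 2\<close> excludes it.\<close>
  with f0 have "w < 0"
    by (cases "w = 0") auto
  moreover have "1 / e \<le> - 1 / w"
    using w(1) e \<open>w < 0\<close> by (simp add: field_simps)
  moreover have "M \<le> 1 / e"
    by (simp add: e_def)
  ultimately have "M < 1 - 1 / w"
    by simp
  moreover have "poly (NRel (path_complement n)) (1 - 1 / w) = 0"
    using w(3) \<open>w < 0\<close> by (subst NRel_path_complement_root_iff) (auto simp: f_def n_def)
  ultimately show ?thesis
    by (intro exI[of _ n] exI[of _ "1 - 1 / w"]) (simp add: n_def)
qed

theorem theorem4:
  shows "\<not> bounded {r :: real. \<exists>G :: nat pair_pre_digraph.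
           pair_graph G \<and> pverts G \<noteq> {} \<and> poly (NRel G) r = 0}"
proof
  assume "bounded {r :: real. \<exists>G :: nat pair_pre_digraph.
           pair_graph G \<and> pverts G \<noteq> {} \<and> poly (NRel G) r = 0}"
  then obtain M where M: "\<And>r G. pair_graph (G :: nat pair_pre_digraph) \<Longrightarrow> pverts G \<noteq> {} \<Longrightarrow>
      poly (NRel G) r = 0 \<Longrightarrow> \<bar>r\<bar> \<le> M"
    unfolding bounded_iff by auto
  obtain n r where nr: "n \<ge> 3" "r > M" "poly (NRel (path_complement n)) r = 0"
    using path_complement_large_root by blast
  have "pverts (path_complement n) \<noteq> {}"
    using nr(1) by (simp add: lessThan_empty_iff)
  from M[OF pair_graph_path_complement this nr(3)] nr(2) show False
    by simp
qed

end
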